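(* Let $\mathbb{A}$ be a BaireCat space and let $\Phi$ be a group of homeomorphisms of $\mathbb{A}$. Suppose there is some member $\mathbf{T}\in\mathbb{A}$ whose $\Phi$-orbit $\{\varphi(\mathbf{T})\mid\varphi\in\Phi\}$ is dense in $\mathbb{A}$. Then each Baire set $B\subset\mathbb{A}$ that is $\Phi$-invariant (i.e. $\varphi(B)=B$ for all $\varphi\in\Phi$) is either meager or residual.
   Context: A subset of a topological space is meager if it is a countable union of nowhere-dense sets; it is residual if its complement is meager. A BaireCat space is a topological space in which each residual set is dense (this is what is traditionally called a Baire space). A Baire set (set with the Property of Baire) is a set of the form $V\bigtriangleup M$ (symmetric difference) with $V$ open and $M$ meager. *)

theory Defs
  imports "HOL-Analysis.Analysis" "HOL-Algebra.Bij"
begin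

(* HOL-Algebra.Congruence also uses the token closure_of (for setoid closure). *)
no_notation eq_closure_of (\<open>closure'_of\<index>\<close>)

definition dense_in :: "'a topology \<Rightarrow> 'a set \<Rightarrow> bool" where
  "dense_in X S \<longleftrightarrow> S \<subseteq> topspace X \<and> X closure_of S = topspace X"

definition nowhere_dense_in :: "'a topology \<Rightarrow> 'a set \<Rightarrow> bool" where
  "nowhere_dense_in X N \<longleftrightarrow> N \<subseteq> topspace X \<and> X interior_of (X closure_of N) = {}"

definition meager_in :: "'a topology \<Rightarrow> 'a set \<Rightarrow> bool" where
  "meager_in X M \<longleftrightarrow> (\<exists>\<N>. countable \<N> \<and> (\<forall>N\<in>\<N>. nowhere_dense_in X N) \<and> M = \<Union>\<N>)"

definition residual_in :: "'a topology \<Rightarrow> 'a set \<Rightarrow> bool" where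
  "residual_in X R \<longleftrightarrow> R \<subseteq> topspace X \<and> meager_in X (topspace X - R)"

definition BaireCat_space :: "'a topology \<Rightarrow> bool" where
  "BaireCat_space X \<longleftrightarrow> (\<forall>R. residual_in X R \<longrightarrow> dense_in X R)"

text \<open>Sets with the Property of Baire (not the Baire sigma-algebra).\<close>
definition Baire_set_in :: "'a topology \<Rightarrow> 'a set \<Rightarrow> bool" where
  "Baire_set_in X B \<longleftrightarrow> (\<exists>V M. openin X V \<and> meager_in X M \<and> B = sym_diff V M)"

text \<open>Elements of \<open>BijGroup (topspace X)\<close> are bijections of the space, taken to be
  \<open>undefined\<close> outside of it so that equality is equality of maps on the space;
  the group operation is composition.\<close>
definition homeomorphism_group :: "'a topology \<Rightarrow> ('a \<Rightarrow> 'a) set \<Rightarrow> bool" where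
  "homeomorphism_group X \<Phi> \<longleftrightarrow>
     subgroup \<Phi> (BijGroup (topspace X)) \<and> (\<forall>\<phi>\<in>\<Phi>. homeomorphic_map X X \<phi>)"

end

theory Submission
  imports Defs
begin

text \<open>
  The complement of a Baire set is again a Baire set, so write
  \<open>B = V \<triangle> M\<close> and \<open>A - B = V' \<triangle> M'\<close>.
  If neither \<open>V\<close> nor \<open>V'\<close> is empty, the dense orbit gives \<open>\<phi> T \<in> V\<close> and \<open>\<psi> T \<in> V'\<close>.
  By invariance of \<open>B\<close>, the open neighbourhood \<open>\<phi>\<inverse>(V) \<inter> \<psi>\<inverse>(V')\<close> of \<open>T\<close> lies in the
  meager set \<open>\<phi>\<inverse>(M) \<union> \<psi>\<inverse>(M')\<close>, which is impossible in a BaireCat space.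
\<close>

lemma meager_in_subset_topspace: "meager_in X M \<Longrightarrow> M \<subseteq> topspace X"
  by (force simp: meager_in_def nowhere_dense_in_def)

lemma nowhere_dense_in_subset:
  assumes "nowhere_dense_in X N" "K \<subseteq> N"
  shows "nowhere_dense_in X K"
  using assms interior_of_mono[OF closure_of_mono[OF assms(2)], of X X]
  by (auto simp: nowhere_dense_in_def)

lemma meager_in_subset:
  assumes "meager_in X M" "K \<subseteq> M"
  shows "meager_in X K"
proof -
  obtain \<N> where N: "countable \<N>" "\<forall>N\<in>\<N>. nowhere_dense_in X N" "M = \<Union>\<N>"
    using assms(1) by (auto simp: meager_in_def)
  have "countable ((\<lambda>N. N \<inter> K) ` \<N>)" using N by simp
  moreover have "\<forall>N\<in>(\<lambda>N. N \<inter> K) ` \<N>. nowhere_dense_in X N"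
    using N(2) by (auto intro: nowhere_dense_in_subset)
  moreover have "K = \<Union>((\<lambda>N. N \<inter> K) ` \<N>)" using N(3) assms(2) by blast
  ultimately show ?thesis unfolding meager_in_def by blast
qed

lemma meager_in_Un:
  assumes "meager_in X M" "meager_in X N"
  shows "meager_in X (M \<union> N)"
proof -
  obtain \<M> \<N> where "countable \<M>" "\<forall>N\<in>\<M>. nowhere_dense_in X N" "M = \<Union>\<M>"
    "countable \<N>" "\<forall>N\<in>\<N>. nowhere_dense_in X N" "N = \<Union>\<N>"
    using assms by (auto simp: meager_in_def)
  then show ?thesis unfolding meager_in_def
    by (intro exI[of _ "\<M> \<union> \<N>"]) auto
qed

lemma nowhere_dense_in_imp_meager_in: "nowhere_dense_in X N \<Longrightarrow> meager_in X N"
  unfolding meager_in_def by (intro exI[of _ "{N}"]) auto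

lemma nowhere_dense_in_homeomorphic_image:
  assumes "homeomorphic_map X Y f" "nowhere_dense_in X N"
  shows "nowhere_dense_in Y (f ` N)"
proof -
  have N: "N \<subseteq> topspace X" "X interior_of (X closure_of N) = {}"
    using assms(2) by (auto simp: nowhere_dense_in_def)
  have "f ` N \<subseteq> topspace Y"
    using N(1) homeomorphic_imp_surjective_map[OF assms(1)] by blast
  moreover have "Y interior_of (Y closure_of (f ` N)) = {}"
    using N assms(1)
    by (simp add: homeomorphic_map_closure_of homeomorphic_map_interior_of closure_of_subset_topspace)
  ultimately show ?thesis by (simp add: nowhere_dense_in_def)
qed

lemma meager_in_homeomorphic_image:
  assumes "homeomorphic_map X Y f" "meager_in X M"
  shows "meager_in Y (f ` M)"
proof -
  obtain \<N> where N: "countable \<N>" "\<forall>N\<in>\<N>. nowhere_dense_in X N" "M = \<Union>\<N>"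
    using assms(2) by (auto simp: meager_in_def)
  have "\<forall>N\<in>(`) f ` \<N>. nowhere_dense_in Y N"
    using N(2) nowhere_dense_in_homeomorphic_image[OF assms(1)] by blast
  moreover have "f ` M = \<Union>((`) f ` \<N>)" using N(3) by blast
  ultimately show ?thesis using N(1) unfolding meager_in_def by blast
qed

lemma meager_in_homeomorphic_preimage:
  assumes "homeomorphic_map X Y f" "meager_in Y M"
  shows "meager_in X {x \<in> topspace X. f x \<in> M}"
proof -
  obtain g where g: "homeomorphic_maps X Y f g"
    using assms(1) homeomorphic_map_maps by blast
  then have "homeomorphic_map Y X g"
    using homeomorphic_maps_map by blast
  from meager_in_homeomorphic_image[OF this assms(2)]
  show ?thesis
    by (rule meager_in_subset) (use g in \<open>force simp: homeomorphic_maps_def\<close>)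
qed

text \<open>An open set that meets the frontier of \<open>V\<close> also meets \<open>V\<close>. The
  interior of the frontier cannot do so, because an open set is disjoint from its frontier. As the
  frontier is closed, taking its closure adds nothing.\<close>

lemma nowhere_dense_in_frontier_of_open:
  assumes "openin X V"
  shows "nowhere_dense_in X (X frontier_of V)"
proof -
  let ?I = "X interior_of (X frontier_of V)"
  have "?I \<inter> V = {}"
    using interior_of_subset[of X "X frontier_of V"] frontier_of_openin[OF assms] by blast
  then have "?I = {}"
    using frontier_of_openin_straddle_Int(1)[OF openin_interior_of, of X "X frontier_of V" V]
      interior_of_subset[of X "X frontier_of V"] by blast
  then show ?thesis
    by (simp add: nowhere_dense_in_def frontier_of_subset_topspace closure_of_closedin
        closedin_frontier_of)
qed

lemma Baire_set_in_subset_topspace: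
  assumes "Baire_set_in X B"
  shows "B \<subseteq> topspace X"
proof -
  obtain V M where VM: "openin X V" "meager_in X M" "B = sym_diff V M"
    using assms by (auto simp: Baire_set_in_def)
  then show ?thesis
    using openin_subset[OF VM(1)] meager_in_subset_topspace[OF VM(2)] by blast
qed

lemma Baire_set_in_complement:
  assumes "Baire_set_in X B"
  shows "Baire_set_in X (topspace X - B)"
proof -
  obtain V M where VM: "openin X V" "meager_in X M" "B = sym_diff V M"
    using assms by (auto simp: Baire_set_in_def)
  \<comment> \<open>The open part of the complement is the exterior of \<open>V\<close>. Passing
    from the closed set \<open>topspace X - V\<close> to its interior \<open>W\<close> loses only
    frontier points of \<open>V\<close>, so the error \<open>K\<close> stays within that frontier
    together with \<open>M\<close>.\<close>
  define W where "W = topspace X - X closure_of V"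
  define K where "K = sym_diff W (topspace X - B)"
  have "V \<subseteq> topspace X" "V \<subseteq> X closure_of V"
    using VM(1) by (auto simp: openin_subset closure_of_subset)
  then have "K \<subseteq> X frontier_of V \<union> M"
    using VM meager_in_subset_topspace[OF VM(2)]
    by (auto simp: K_def W_def frontier_of_def interior_of_openin)
  then have "meager_in X K"
    by (rule meager_in_subset[rotated])
      (intro meager_in_Un nowhere_dense_in_imp_meager_in nowhere_dense_in_frontier_of_open VM)
  moreover have "openin X W" by (auto simp: W_def)
  moreover have "topspace X - B = sym_diff W K" by (auto simp: K_def)
  ultimately show ?thesis unfolding Baire_set_in_def by blast
qed

text \<open>The complement of \<open>U\<close> is residual, hence dense, but it is also closed, so
  it is the whole space.\<close>

lemma BaireCat_space_open_meager_in:
  assumes "BaireCat_space X" "openin X U" "meager_in X U"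
  shows "U = {}"
proof -
  have U: "U \<subseteq> topspace X" using assms(2) by (rule openin_subset)
  then have "residual_in X (topspace X - U)"
    using assms(3) by (simp add: residual_in_def double_diff)
  then have "X closure_of (topspace X - U) = topspace X"
    using assms(1) by (auto simp: BaireCat_space_def dense_in_def)
  moreover have "X closure_of (topspace X - U) = topspace X - U"
    using assms(2) by (intro closure_of_closedin closedin_diff closedin_topspace)
  ultimately show ?thesis using U by blast
qed

lemma dense_in_meets_open:
  assumes "dense_in X S" "openin X U" "U \<noteq> {}"
  obtains x where "x \<in> S" "x \<in> U"
proof -
  obtain u where "u \<in> U" "u \<in> X closure_of S"
    using assms(1,3) openin_subset[OF assms(2)] unfolding dense_in_def by blast
  then show thesis
    using that assms(2) unfolding in_closure_of by blast
qed

theorem mainTheorem2: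
  fixes A :: "'a topology" and \<Phi> :: "('a \<Rightarrow> 'a) set" and T :: 'a and B :: "'a set"
  assumes "BaireCat_space A"
    and "homeomorphism_group A \<Phi>"
    and "T \<in> topspace A"
    and "dense_in A {\<phi> T |\<phi>. \<phi> \<in> \<Phi>}"
    and "Baire_set_in A B"
    and "\<forall>\<phi>\<in>\<Phi>. \<phi> ` B = B"
  shows "meager_in A B \<or> residual_in A B"
proof -
  \<comment> \<open>Invariance sends points of \<open>B\<close> into \<open>B\<close>; injectivity
    of \<phi> on the space gives the converse, so membership in \<open>B\<close> is constant along
    orbits.\<close>
  have B_iff: "\<phi> x \<in> B \<longleftrightarrow> x \<in> B" if "\<phi> \<in> \<Phi>" "x \<in> topspace A" for \<phi> x
  proof -
    have "inj_on \<phi> (topspace A)"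
      using assms(2) that homeomorphic_imp_injective_map by (auto simp: homeomorphism_group_def)
    then have "\<phi> x \<in> \<phi> ` B \<longleftrightarrow> x \<in> B"
      using that(2) Baire_set_in_subset_topspace[OF assms(5)] by (rule inj_on_image_mem_iff)
    then show ?thesis using assms(6) that(1) by simp
  qed
  obtain V M where VM: "openin A V" "meager_in A M" "B = sym_diff V M"
    using assms(5) by (auto simp: Baire_set_in_def)
  obtain V' M' where VM': "openin A V'" "meager_in A M'" "topspace A - B = sym_diff V' M'"
    using Baire_set_in_complement[OF assms(5)] by (auto simp: Baire_set_in_def)
  consider "V = {}" | "V' = {}" | "V \<noteq> {}" "V' \<noteq> {}" by blast
  then show ?thesis
  proof cases
    \<comment> \<open>An empty open part leaves only the meager one: here \<open>B = M\<close>, and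
      in the next case the complement of \<open>B\<close> is \<open>M'\<close>.\<close>
    case 1
    then show ?thesis using VM by simp
  next
    case 2
    then show ?thesis
      using VM' Baire_set_in_subset_topspace[OF assms(5)] by (simp add: residual_in_def)
  next
    case 3
    obtain \<phi> where \<phi>: "\<phi> \<in> \<Phi>" "\<phi> T \<in> V"
      using dense_in_meets_open[OF assms(4) VM(1) 3(1)] by blast
    obtain \<psi> where \<psi>: "\<psi> \<in> \<Phi>" "\<psi> T \<in> V'"
      using dense_in_meets_open[OF assms(4) VM'(1) 3(2)] by blast
    have hom: "homeomorphic_map A A \<phi>" "homeomorphic_map A A \<psi>"
      using assms(2) \<phi>(1) \<psi>(1) by (auto simp: homeomorphism_group_def)
    define U where "U = {x \<in> topspace A. \<phi> x \<in> V} \<inter> {x \<in> topspace A. \<psi> x \<in> V'}"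
    have "openin A U"
      unfolding U_def using hom VM(1) VM'(1)
      by (intro openin_Int openin_continuous_map_preimage)
        (auto intro: homeomorphic_imp_continuous_map)
    \<comment> \<open>Split on whether \<open>x\<close> is in \<open>B\<close>. If not, then
      \<open>\<phi> x\<close> is in \<open>V\<close> but not in \<open>B\<close>, so it is in
      \<open>M\<close>. If so, then \<open>\<psi> x\<close> is in \<open>V'\<close> and in
      \<open>B\<close>, so it is in \<open>M'\<close>.\<close>
    moreover have "U \<subseteq> {x \<in> topspace A. \<phi> x \<in> M} \<union> {x \<in> topspace A. \<psi> x \<in> M'}"
    proof
      fix x assume x: "x \<in> U"
      then have "x \<in> topspace A" "\<phi> x \<in> V" "\<psi> x \<in> V'" by (auto simp: U_def)
      then show "x \<in> {x \<in> topspace A. \<phi> x \<in> M} \<union> {x \<in> topspace A. \<psi> x \<in> M'}"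
        using B_iff[OF \<phi>(1)] B_iff[OF \<psi>(1)] VM(3) VM'(3) by blast
    qed
    then have "meager_in A U"
      by (rule meager_in_subset[rotated])
        (intro meager_in_Un meager_in_homeomorphic_preimage[OF hom(1) VM(2)]
          meager_in_homeomorphic_preimage[OF hom(2) VM'(2)])
    ultimately have "U = {}"
      using assms(1) BaireCat_space_open_meager_in by blast
    moreover have "T \<in> U" using assms(3) \<phi>(2) \<psi>(2) by (simp add: U_def)
    ultimately show ?thesis by blast
  qed
qed

end
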